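(* Let $\{S_t\}$, $S_t\in\mathbb{R}^{m\times n}$, be a sequence of i.i.d. random embeddings that satisfy the first and second inverse unbiased moments condition, with constants $\theta_1,\theta_2>0$. Given step size and momentum parameters $\mu,\beta$, there exist initial points $x_0,x_1\in\mathbb{R}^d$ such that the error of Polyak-IHS, whose iterates are $x_{t+1}=x_t-\mu H_{S_t}^\dagger\nabla f(x_t)+\beta(x_t-x_{t-1})$, is lower bounded as $$\limsup_{t\to\infty}\Big(\frac{\mathbb{E}\{\delta_t\}}{\mathbb{E}\{\delta_0\}}\Big)^{1/t}\ \ge\ 1-\frac{\theta_1^2}{\theta_2}.$$
   Context: Let $n\ge d$, let $A\in\mathbb{R}^{n\times d}$ have full column rank, $b\in\mathbb{R}^d$, $H=A^\top A$, $f(x)=\frac12\langle x,Hx\rangle-\langle b,x\rangle$, $x^*=\mathrm{argmin}_x f(x)$, and $\delta_t=\frac12\langle x_t-x^*,H(x_t-x^* )\rangle$. For $S\in\mathbb{R}^{m\times n}$ set $H_S=A^\top S^\top SA$; $\dagger$ denotes the pseudo-inverse. The matrices $S_tA$ are assumed to have full column rank almost surely. Polyak-IHS is the iterative Hessian sketch with heavy-ball momentum; its recursion is run for $t\ge1$ from the two initial points $x_0,x_1$. Inverse unbiased moments condition: a random embedding $S\in\mathbb{R}^{m\times n}$ satisfies the first and second inverse unbiased moments condition if there exists $m_0\ge1$ such that for any $m\ge m_0$ there exist finite real numbers $\theta_1,\theta_2>0$ such that $\mathbb{E}\{C_S^{-1}\}=\theta_1 I_d$ and $\mathbb{E}\{C_S^{-2}\}=\theta_2I_d$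 for any matrix $U\in\mathbb{R}^{n\times d}$ with orthonormal columns, where $C_S=U^\top S^\top SU$. In the claim, $m\ge m_0$ and $\theta_1,\theta_2$ are the constants for this $m$. *)

theory Defs
  imports "HOL-Probability.Probability"
begin

section \<open>Least squares\<close>

definition hessian :: "real^'d^'n \<Rightarrow> real^'d^'d" where
  "hessian A = transpose A ** A"

definition objective :: "real^'d^'n \<Rightarrow> real^'d \<Rightarrow> real^'d \<Rightarrow> real" where
  "objective A b x = 1/2 * (x \<bullet> (hessian A *v x)) - b \<bullet> x"

definition minimizer :: "real^'d^'n \<Rightarrow> real^'d \<Rightarrow> real^'d" where
  "minimizer A b = arg_min (objective A b) (\<lambda>_. True)"

definition gradient :: "('a::real_inner \<Rightarrow> real) \<Rightarrow> 'a \<Rightarrow> 'a" where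
  "gradient f x = (THE g. GDERIV f x :> g)"

definition error :: "real^'d^'n \<Rightarrow> real^'d \<Rightarrow> real^'d \<Rightarrow> real" where
  "error A b x = 1/2 * ((x - minimizer A b) \<bullet> (hessian A *v (x - minimizer A b)))"

section \<open>Moore-Penrose pseudo-inverse\<close>

definition is_pseudo_inverse :: "real^'a^'b \<Rightarrow> real^'b^'a \<Rightarrow> bool" where
  "is_pseudo_inverse B X \<longleftrightarrow>
     B ** X ** B = B \<and> X ** B ** X = X \<and>
     transpose (B ** X) = B ** X \<and> transpose (X ** B) = X ** B"

definition pseudo_inverse :: "real^'a^'b \<Rightarrow> real^'b^'a" where
  "pseudo_inverse B = (THE X. is_pseudo_inverse B X)"

lemma is_pseudo_inverse_unique:
  assumes X: "is_pseudo_inverse B X" and Y: "is_pseudo_inverse B Y"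
  shows "X = Y"
proof -
  have BX: "B ** X = B ** Y"
  proof -
    have "B ** X = transpose (B ** X)" using X by (simp add: is_pseudo_inverse_def)
    also have "\<dots> = transpose ((B ** Y) ** (B ** X))"
      using Y by (simp add: is_pseudo_inverse_def matrix_mul_assoc)
    also have "\<dots> = transpose (B ** X) ** transpose (B ** Y)" by (rule matrix_transpose_mul)
    also have "\<dots> = (B ** X) ** (B ** Y)" using X Y by (simp add: is_pseudo_inverse_def)
    also have "\<dots> = B ** Y" using X by (simp add: is_pseudo_inverse_def matrix_mul_assoc)
    finally show ?thesis .
  qed
  have XB: "X ** B = Y ** B"
  proof -
    have "X ** B = transpose (X ** B)" using X by (simp add: is_pseudo_inverse_def)
    also have "\<dots> = transpose ((X ** B) ** (Y ** B))"
      using Y by (metis is_pseudo_inverse_def matrix_mul_assoc)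
    also have "\<dots> = transpose (Y ** B) ** transpose (X ** B)" by (rule matrix_transpose_mul)
    also have "\<dots> = (Y ** B) ** (X ** B)" using X Y by (simp add: is_pseudo_inverse_def)
    also have "\<dots> = Y ** B" using X by (metis is_pseudo_inverse_def matrix_mul_assoc)
    finally show ?thesis .
  qed
  have "X = X ** B ** X" using X by (simp add: is_pseudo_inverse_def)
  also have "\<dots> = Y ** B ** X" by (simp add: XB)
  also have "\<dots> = Y ** (B ** Y)" by (simp add: BX matrix_mul_assoc[symmetric])
  also have "\<dots> = Y" using Y by (simp add: is_pseudo_inverse_def matrix_mul_assoc)
  finally show ?thesis .
qed

lemma pseudo_inverse_eqI: "is_pseudo_inverse B X \<Longrightarrow> pseudo_inverse B = X"
  unfolding pseudo_inverse_def by (blast intro: the_equality is_pseudo_inverse_unique)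

lemma pseudo_inverse_invertible:
  fixes B :: "real^'a^'a"
  assumes "invertible B"
  shows "pseudo_inverse B = matrix_inv B"
proof (rule pseudo_inverse_eqI)
  have "B ** matrix_inv B = mat 1 \<and> matrix_inv B ** B = mat 1"
    using assms unfolding invertible_def matrix_inv_def by (rule someI_ex)
  then show "is_pseudo_inverse B (matrix_inv B)"
    by (simp add: is_pseudo_inverse_def transpose_mat)
qed

section \<open>Sketching matrices\<close>

text \<open>The inverse unbiased moments condition quantifies over the number m of rows, so m cannot be a
  type here. A real matrix with m rows and column index type \<open>'n\<close> is given by the function
  sending \<open>i < m\<close> to row i; its values at \<open>i \<ge> m\<close> are never used.\<close>

type_synonym 'n sketch = "nat \<Rightarrow> real^'n"

text \<open>The matrix \<open>S\<^sup>T S\<close>, entry by entry.\<close>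

definition sketch_gram :: "nat \<Rightarrow> 'n sketch \<Rightarrow> real^'n^'n" where
  "sketch_gram m s = (\<chi> j k. \<Sum>i<m. s i $ j * s i $ k)"

text \<open>\<open>B\<^sup>T S\<^sup>T S B\<close>: this is \<open>H\<^sub>S\<close> for \<open>B = A\<close> and \<open>C\<^sub>S\<close> for \<open>B = U\<close>.\<close>

definition sketched_gram :: "nat \<Rightarrow> 'n::finite sketch \<Rightarrow> real^'d^'n \<Rightarrow> real^'d^'d" where
  "sketched_gram m s B = transpose B ** sketch_gram m s ** B"

text \<open>Row i of \<open>S B\<close> is the row vector \<open>s i\<close> times \<open>B\<close>; the rank is the dimension of the row space,
  as in the definition of \<^const>\<open>rank\<close>.\<close>

definition sketch_mult :: "'n::finite sketch \<Rightarrow> real^'d^'n \<Rightarrow> 'd sketch" where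
  "sketch_mult s B = (\<lambda>i. s i v* B)"

definition sketch_rank :: "nat \<Rightarrow> 'n::finite sketch \<Rightarrow> nat" where
  "sketch_rank m s = dim (s ` {..<m})"

definition sketch_space :: "nat \<Rightarrow> 'n::finite sketch measure" where
  "sketch_space m = (\<Pi>\<^sub>M i\<in>{..<m}. borel)"

section \<open>Inverse unbiased moments\<close>

text \<open>A random embedding is a family of laws: \<open>D m\<close> is the law of the random matrix with m rows.\<close>

definition random_embedding :: "(nat \<Rightarrow> 'n::finite sketch measure) \<Rightarrow> bool" where
  "random_embedding D \<longleftrightarrow> (\<forall>m\<ge>1. prob_space (D m) \<and> sets (D m) = sets (sketch_space m))"

text \<open>The moment identities for one m. Both the almost sure invertibility of \<open>C\<^sub>S\<close> and the
  existence of the expectations are part of their meaning. The first argument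
  only carries the type indexing the d columns of \<open>U\<close>.\<close>

definition inverse_moments ::
  "'d::finite itself \<Rightarrow> nat \<Rightarrow> 'n::finite sketch measure \<Rightarrow> real \<Rightarrow> real \<Rightarrow> bool" where
  "inverse_moments (_ :: 'd itself) m \<D> \<theta>1 \<theta>2 \<longleftrightarrow>
     0 < \<theta>1 \<and> 0 < \<theta>2 \<and>
     (\<forall>U :: real^'d^'n. transpose U ** U = mat 1 \<longrightarrow>
        (AE s in \<D>. invertible (sketched_gram m s U)) \<and>
        has_bochner_integral \<D> (\<lambda>s. matrix_inv (sketched_gram m s U)) (\<theta>1 *\<^sub>R mat 1) \<and>
        has_bochner_integral \<D>
          (\<lambda>s. matrix_inv (sketched_gram m s U) ** matrix_inv (sketched_gram m s U))
          (\<theta>2 *\<^sub>R mat 1))"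

text \<open>The condition, with its threshold \<open>m\<^sub>0\<close> exposed.\<close>

definition inverse_unbiased_moments ::
  "'d::finite itself \<Rightarrow> (nat \<Rightarrow> 'n::finite sketch measure) \<Rightarrow> nat \<Rightarrow> bool" where
  "inverse_unbiased_moments T D m0 \<longleftrightarrow>
     1 \<le> m0 \<and> (\<forall>m\<ge>m0. \<exists>\<theta>1 \<theta>2. inverse_moments T m (D m) \<theta>1 \<theta>2)"

section \<open>Polyak-IHS\<close>

text \<open>The iterates for a realization \<open>s\<close> of the sequence of sketching matrices; \<open>s 0\<close> is unused.\<close>

fun polyak_ihs :: "real^'d^'n \<Rightarrow> real^'d \<Rightarrow> nat \<Rightarrow> real \<Rightarrow> real \<Rightarrow> real^'d \<Rightarrow> real^'d \<Rightarrow>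
    (nat \<Rightarrow> 'n::finite sketch) \<Rightarrow> nat \<Rightarrow> real^'d" where
  "polyak_ihs A b m \<mu> \<beta> x0 x1 s 0 = x0"
| "polyak_ihs A b m \<mu> \<beta> x0 x1 s (Suc 0) = x1"
| "polyak_ihs A b m \<mu> \<beta> x0 x1 s (Suc (Suc t)) =
     polyak_ihs A b m \<mu> \<beta> x0 x1 s (Suc t)
     - \<mu> *\<^sub>R (pseudo_inverse (sketched_gram m (s (Suc t)) A)
             *v gradient (objective A b) (polyak_ihs A b m \<mu> \<beta> x0 x1 s (Suc t)))
     + \<beta> *\<^sub>R (polyak_ihs A b m \<mu> \<beta> x0 x1 s (Suc t) - polyak_ihs A b m \<mu> \<beta> x0 x1 s t)"

definition expected_error :: "'w measure \<Rightarrow> real^'d^'n \<Rightarrow> real^'d \<Rightarrow> nat \<Rightarrow> real \<Rightarrow> real \<Rightarrow>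
    (nat \<Rightarrow> 'w \<Rightarrow> 'n::finite sketch) \<Rightarrow> real^'d \<Rightarrow> real^'d \<Rightarrow> nat \<Rightarrow> real" where
  "expected_error M A b m \<mu> \<beta> S x0 x1 t =
     (LINT \<omega>|M. error A b (polyak_ihs A b m \<mu> \<beta> x0 x1 (\<lambda>k. S k \<omega>) t))"

end

theory Submission
  imports Defs "HOL-Real_Asymp.Real_Asymp"
begin

text \<open>
  Factor \<open>A = U R\<close> with orthonormal \<open>U\<close> and invertible \<open>R\<close>. In the variable \<open>z\<^sub>t = R (x\<^sub>t - x*)\<close> the
  iteration reads \<open>z\<^sub>t\<^sub>+\<^sub>1 = (1 + \<beta>) z\<^sub>t - \<mu> P\<^sub>t z\<^sub>t - \<beta> z\<^sub>t\<^sub>-\<^sub>1\<close>, where \<open>P\<^sub>t\<close> is the inverse of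
  \<open>U\<^sup>T S\<^sub>t\<^sup>T S\<^sub>t U\<close>, and \<open>\<delta>\<^sub>t = |z\<^sub>t|\<^sup>2 / 2\<close>. As \<open>P\<^sub>t\<close> is independent of \<open>z\<^sub>t\<close> and \<open>z\<^sub>t\<^sub>-\<^sub>1\<close>, the unbiased
  inverse moments give a three-term linear recursion for \<open>E |z\<^sub>t|\<^sup>2\<close>, \<open>E (z\<^sub>t \<bullet> z\<^sub>t\<^sub>-\<^sub>1)\<close> and
  \<open>E |z\<^sub>t\<^sub>-\<^sub>1|\<^sup>2\<close>. For all \<open>\<mu>\<close> and \<open>\<beta>\<close> its matrix has a real eigenvalue \<open>l \<ge> 1 - \<theta>1\<^sup>2 / \<theta>2\<close>. Pairing the
  moments with a left eigenvector gives a quantity proportional to \<open>l ^ t\<close>, nonzero for suitable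
  collinear initial points, and by the Cauchy-Schwarz inequality it is \<open>O(E \<delta>\<^sub>t + E \<delta>\<^sub>t\<^sub>-\<^sub>1)\<close>.
\<close>

section \<open>Growth of the moment recursion\<close>

text \<open>If the limsup were below \<open>l\<close>, then \<open>a t\<close> would eventually be
  at most \<open>K * r ^ t\<close> for some \<open>r < l\<close>. Two consecutive terms would then
  sum to a multiple of \<open>r ^ t\<close>, which falls below \<open>c * l ^ t\<close>. Sums of
  neighbours are used because the conserved quantity of the recursion involves two time
  steps.\<close>

lemma limsup_root_ge:
  fixes a :: "nat \<Rightarrow> real"
  assumes nonneg: "\<And>t. 0 \<le> a t" and K: "0 < K" and c: "0 < c" and l: "0 < l"
    and growth: "\<And>t. c * l ^ t \<le> a (Suc t) + a t"
  shows "limsup (\<lambda>t. ereal ((a t / K) powr (1 / real t))) \<ge> ereal l"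
proof (rule ccontr)
  assume "\<not> ?thesis"
  then have "limsup (\<lambda>t. ereal ((a t / K) powr (1 / real t))) < ereal l" by simp
  then obtain q where q: "limsup (\<lambda>t. ereal ((a t / K) powr (1 / real t))) < ereal q" "ereal q < ereal l"
    using ereal_dense2 by blast
  \<comment> \<open>The separating number \<open>q\<close> may be nonpositive; the maximum with
    \<open>l / 2\<close> keeps the geometric rate positive and still below \<open>l\<close>.\<close>
  define r where "r = max q (l / 2)"
  have r: "0 < r" "r < l" "q \<le> r" using q l by (auto simp: r_def)
  have "eventually (\<lambda>t. ereal ((a t / K) powr (1 / real t)) < ereal q) sequentially"
    by (rule Limsup_lessD) (rule q)
  then have "eventually (\<lambda>t. a t \<le> K * r ^ t) sequentially"
    using eventually_gt_at_top[of 0]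
  proof eventually_elim
    case (elim t)
    show ?case
    proof (cases "a t = 0")
      case True
      then show ?thesis using K r by simp
    next
      case False
      with nonneg[of t] K have pos: "0 < a t / K" by (simp add: less_le)
      have "a t / K = ((a t / K) powr (1 / real t)) powr (real t)"
        using pos elim by (simp add: powr_powr del: zero_less_divide_iff abs_divide)
      also have "\<dots> \<le> r powr (real t)"
        using elim r by (intro powr_mono2) auto
      also have "\<dots> = r ^ t" using r by (simp add: powr_realpow)
      finally show ?thesis using K by (simp add: field_simps)
    qed
  qed
  then have ev: "eventually (\<lambda>t. a t \<le> K * r ^ t \<and> a (Suc t) \<le> K * r ^ Suc t) sequentially"
    by (intro eventually_conj) (auto simp: eventually_sequentially_Suc[of "\<lambda>t. a t \<le> K * r ^ t"] simp del: power_Suc)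
  have "(\<lambda>t. K * (r + 1) * (r / l) ^ t) \<longlonglongrightarrow> K * (r + 1) * 0"
    using r l by (intro tendsto_mult_left LIMSEQ_power_zero) auto
  then have "eventually (\<lambda>t. K * (r + 1) * (r / l) ^ t < c) sequentially"
    using c by (intro order_tendstoD(2)) auto
  with ev have "eventually (\<lambda>t. False) sequentially"
  proof eventually_elim
    case (elim t)
    have "c * l ^ t \<le> K * (r + 1) * r ^ t"
      using growth[of t] elim(1) by (simp add: algebra_simps)
    then have "c \<le> K * (r + 1) * (r / l) ^ t"
      using l by (simp add: power_divide field_simps)
    with elim(2) show False by simp
  qed
  then show False by simp
qed

text \<open>The cubic is the characteristic polynomial of the linear map that carries the moments
  \<open>(E |z\<^sub>t|\<^sup>2, E (z\<^sub>t \<bullet> z\<^sub>t\<^sub>-\<^sub>1), E |z\<^sub>t\<^sub>-\<^sub>1|\<^sup>2)\<close> to the next time step. It is nonpositive at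
  \<open>max \<bar>\<beta>\<bar> (1 - \<theta>1\<^sup>2 / \<theta>2)\<close>.\<close>

lemma sketch_cubic_root:
  fixes \<theta>1 \<theta>2 \<mu> \<beta> :: real
  assumes \<theta>: "0 < \<theta>1" "0 < \<theta>2" and rho: "0 < 1 - \<theta>1\<^sup>2 / \<theta>2"
  defines "\<alpha> \<equiv> 1 + \<beta> - \<mu> * \<theta>1"
    and "p \<equiv> (1 + \<beta>)\<^sup>2 - 2 * (1 + \<beta>) * \<mu> * \<theta>1 + \<mu>\<^sup>2 * \<theta>2"
  obtains l where "1 - \<theta>1\<^sup>2 / \<theta>2 \<le> l"
    "l * (l - p) * (l + \<beta>) + 2 * \<beta> * \<alpha>\<^sup>2 * l - \<beta>\<^sup>2 * (l + \<beta>) = 0"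
proof -
  define \<sigma> where "\<sigma> = \<theta>1\<^sup>2 / \<theta>2"
  define \<rho> where "\<rho> = 1 - \<sigma>"
  define u where "u = \<mu> * \<theta>1"
  \<comment> \<open>This is \<open>p - \<alpha>\<^sup>2\<close>, the contribution of the variance of
    the sketch. The identity \<open>\<sigma> * \<kappa> = \<rho> * u\<^sup>2\<close> is where the
    rate \<open>\<rho>\<close> enters.\<close>
  define \<kappa> where "\<kappa> = \<mu>\<^sup>2 * \<theta>2 - u\<^sup>2"
  define \<phi> where "\<phi> z = z * (z - p) * (z + \<beta>) + 2 * \<beta> * \<alpha>\<^sup>2 * z - \<beta>\<^sup>2 * (z + \<beta>)" for z
  have \<sigma>: "0 < \<sigma>" "\<theta>1\<^sup>2 = \<sigma> * \<theta>2" using \<theta> by (simp_all add: \<sigma>_def)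
  have \<rho>: "0 < \<rho>" "\<sigma> = 1 - \<rho>" using rho by (simp_all add: \<rho>_def \<sigma>_def)
  have \<kappa>\<sigma>: "\<sigma> * \<kappa> = \<rho> * u\<^sup>2"
  proof -
    have "\<sigma> * (\<mu>\<^sup>2 * \<theta>2) = u\<^sup>2" using \<sigma>(2) by (simp add: u_def power_mult_distrib)
    then show ?thesis by (simp add: \<kappa>_def \<rho>_def algebra_simps)
  qed
  have \<kappa>0: "0 \<le> \<kappa>"
    using \<kappa>\<sigma> \<rho>(1) \<sigma>(1) by (metis mult_nonneg_nonneg zero_le_power2 less_imp_le zero_le_mult_iff not_less)
  \<comment> \<open>For \<open>\<kappa> = 0\<close> this is the characteristic polynomial of the
    symmetric square of the deterministic heavy-ball map: if \<open>x\<close> and \<open>y\<close>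
    are the roots of \<open>z\<^sup>2 - \<alpha> * z + \<beta>\<close>, its roots are
    \<open>x\<^sup>2\<close>, \<open>x * y = \<beta>\<close> and \<open>y\<^sup>2\<close>. The last
    summand is the perturbation by the variance.\<close>
  have \<phi>: "\<phi> z = (z - \<beta>) * ((z + \<beta>)\<^sup>2 - \<alpha>\<^sup>2 * z) - \<kappa> * z * (z + \<beta>)" for z
    unfolding \<phi>_def p_def \<kappa>_def \<alpha>_def u_def by algebra
  \<comment> \<open>At \<open>\<bar>\<beta>\<bar>\<close> one of the factors
    \<open>z - \<beta>\<close> and \<open>z + \<beta>\<close> vanishes, so the sign is visible at
    once. This point only helps if it is at least \<open>\<rho>\<close>; otherwise
    \<open>\<rho>\<close> itself is tested.\<close>
  have low: "\<exists>z\<ge>\<rho>. \<phi> z \<le> 0"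
  proof (cases "\<bar>\<beta>\<bar> < \<rho>")
    case False
    have "\<phi> \<bar>\<beta>\<bar> \<le> 0"
    proof (cases "0 \<le> \<beta>")
      case True
      then show ?thesis using \<kappa>0 by (simp add: \<phi>)
    next
      case neg: False
      have "\<phi> (- \<beta>) = - (2 * (\<alpha> * \<beta>)\<^sup>2)" by (simp add: \<phi> power2_eq_square)
      also have "\<dots> \<le> 0" by simp
      finally show ?thesis using neg by simp
    qed
    with False show ?thesis by (intro exI[of _ "\<bar>\<beta>\<bar>"]) auto
  next
    case True
    \<comment> \<open>\<open>P\<close> and \<open>Q\<close> are the coefficients of
      \<open>\<alpha>\<^sup>2\<close> and \<open>u\<^sup>2\<close> in
      \<open>- \<sigma> * \<phi> \<rho>\<close>, once \<open>\<sigma> * \<kappa>\<close> has been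
      replaced by \<open>\<rho> * u\<^sup>2\<close>.\<close>
    define P where "P = \<sigma> * \<rho> * (\<rho> - \<beta>)"
    define Q where "Q = \<rho>\<^sup>2 * (\<rho> + \<beta>)"
    have b: "0 < \<rho> - \<beta>" "0 < \<rho> + \<beta>" using True by auto
    have PQ: "0 < P + Q" using b \<sigma> \<rho> by (auto simp: P_def Q_def intro!: add_pos_pos)
    have \<phi>\<rho>: "\<sigma> * \<phi> \<rho> = \<sigma> * (\<rho> - \<beta>) * (\<rho> + \<beta>)\<^sup>2 - P * \<alpha>\<^sup>2 - Q * u\<^sup>2"
    proof -
      have "\<sigma> * \<phi> \<rho> = \<sigma> * (\<rho> - \<beta>) * ((\<rho> + \<beta>)\<^sup>2 - \<alpha>\<^sup>2 * \<rho>) - (\<sigma> * \<kappa>) * \<rho> * (\<rho> + \<beta>)"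
        by (simp add: \<phi> algebra_simps)
      also have "\<dots> = \<sigma> * (\<rho> - \<beta>) * (\<rho> + \<beta>)\<^sup>2 - P * \<alpha>\<^sup>2 - Q * u\<^sup>2"
        unfolding \<kappa>\<sigma> P_def Q_def by algebra
      finally show ?thesis .
    qed
    \<comment> \<open>Minimizing \<open>P \<alpha>\<^sup>2 + Q u\<^sup>2\<close> subject to \<open>\<alpha> + u = 1 + \<beta>\<close> leaves a perfect square.\<close>
    have "(P + Q) * (P * \<alpha>\<^sup>2 + Q * u\<^sup>2 - \<sigma> * (\<rho> - \<beta>) * (\<rho> + \<beta>)\<^sup>2)
        = (P * \<alpha> - Q * u)\<^sup>2 + \<sigma> * \<rho> * (\<rho> - \<beta>) * (\<rho> + \<beta>) * (\<sigma> * \<beta>)\<^sup>2"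
      unfolding P_def Q_def \<alpha>_def u_def \<rho>(2) by algebra
    also have "\<dots> \<ge> 0" using b \<sigma> \<rho> by auto
    finally have "0 \<le> P * \<alpha>\<^sup>2 + Q * u\<^sup>2 - \<sigma> * (\<rho> - \<beta>) * (\<rho> + \<beta>)\<^sup>2"
      using PQ by (simp add: zero_le_mult_iff)
    with \<phi>\<rho> have "\<sigma> * \<phi> \<rho> \<le> 0" by simp
    then have "\<phi> \<rho> \<le> 0" using \<sigma>(1) by (simp add: mult_le_0_iff)
    then show ?thesis by auto
  qed
  then obtain z where z: "\<rho> \<le> z" "\<phi> z \<le> 0" by auto
  \<comment> \<open>The cubic is monic, so it becomes nonnegative to the right of \<open>z\<close>,
    and the intermediate value theorem gives a root in between.\<close>
  have "filterlim \<phi> at_top at_top" unfolding \<phi>_def by real_asymp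
  then have "eventually (\<lambda>x. 0 \<le> \<phi> x \<and> z \<le> x) at_top"
    using eventually_ge_at_top[of z] by (auto simp: filterlim_at_top eventually_conj_iff)
  then obtain y where y: "0 \<le> \<phi> y" "z \<le> y" by (auto simp: eventually_at_top_linorder)
  have "continuous_on {z..y} \<phi>" unfolding \<phi>_def by (intro continuous_intros)
  from IVT'[OF z(2) y this] obtain l where "z \<le> l" "\<phi> l = 0" by auto
  with z that[of l] show thesis by (auto simp: \<phi>_def \<rho>_def \<sigma>_def)
qed

text \<open>A root of the characteristic polynomial is an eigenvalue, and the eigenvector can be
  written down explicitly. The condition on \<open>u\<close> and \<open>v\<close> makes the
  associated quadratic form in the initial ratio nonconstant.\<close>

lemma moment_matrix_left_eigenvector:
  fixes \<theta>1 \<theta>2 \<mu> \<beta> :: real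
  assumes \<theta>: "0 < \<theta>1" "0 < \<theta>2" and rho: "0 < 1 - \<theta>1\<^sup>2 / \<theta>2"
  defines "\<alpha> \<equiv> 1 + \<beta> - \<mu> * \<theta>1"
    and "p \<equiv> (1 + \<beta>)\<^sup>2 - 2 * (1 + \<beta>) * \<mu> * \<theta>1 + \<mu>\<^sup>2 * \<theta>2"
  obtains l u v w where "1 - \<theta>1\<^sup>2 / \<theta>2 \<le> l"
    "u * p + v * \<alpha> + w = l * u" "- 2 * \<beta> * \<alpha> * u - \<beta> * v = l * v" "\<beta>\<^sup>2 * u = l * w"
    "u \<noteq> 0 \<or> v \<noteq> 0"
proof -
  obtain l where l: "1 - \<theta>1\<^sup>2 / \<theta>2 \<le> l"
    and root: "l * (l - p) * (l + \<beta>) + 2 * \<beta> * \<alpha>\<^sup>2 * l - \<beta>\<^sup>2 * (l + \<beta>) = 0"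
    using sketch_cubic_root[OF \<theta> rho] unfolding \<alpha>_def p_def by blast
  have "0 < l" using l rho by simp
  show thesis
  proof (cases "l + \<beta> = 0")
    \<comment> \<open>The general formula below degenerates to zero here. The cubic then forces
      \<open>\<alpha> = 0\<close>, and the mixed moment alone is an eigenvector.\<close>
    case True
    with root \<open>0 < l\<close> have "\<alpha> = 0" by auto
    with True show thesis by (intro that[of l 0 1 0] l) auto
  next
    case False
    show thesis
    \<comment> \<open>The second and third equations determine the vector up to scale; the first
      equation is then the cubic.\<close>
    proof (rule that[of l "l * (l + \<beta>)" "- 2 * \<beta> * \<alpha> * l" "\<beta>\<^sup>2 * (l + \<beta>)"])
      show "l * (l + \<beta>) * p + - 2 * \<beta> * \<alpha> * l * \<alpha> + \<beta>\<^sup>2 * (l + \<beta>) = l * (l * (l + \<beta>))"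
        using root by algebra
      show "1 - \<theta>1\<^sup>2 / \<theta>2 \<le> l" by (rule l)
      show "l * (l + \<beta>) \<noteq> 0 \<or> - 2 * \<beta> * \<alpha> * l \<noteq> 0" using False \<open>0 < l\<close> by simp
    qed (simp_all add: algebra_simps power2_eq_square)
  qed
qed

text \<open>A polynomial of degree at most two that vanishes at 0, 1 and -1 is zero. The value
  \<open>s\<close> will be the ratio of the two collinear initial vectors.\<close>

lemma binary_quadratic_form_nonzero:
  fixes u v w :: real
  assumes "u \<noteq> 0 \<or> v \<noteq> 0"
  obtains s where "u * s\<^sup>2 + v * s + w \<noteq> 0"
proof -
  have "\<not> (u * 0\<^sup>2 + v * 0 + w = 0 \<and> u * 1\<^sup>2 + v * 1 + w = 0 \<and> u * (-1)\<^sup>2 + v * (-1) + w = 0)"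
    using assms by auto
  with that show thesis by blast
qed

lemma moment_recursion_limsup:
  fixes a c :: "nat \<Rightarrow> real" and \<mu> \<beta> \<theta>1 \<theta>2 :: real
  assumes eig: "u * p + v * \<alpha> + w = l * u" "- 2 * \<beta> * \<alpha> * u - \<beta> * v = l * v" "\<beta>\<^sup>2 * u = l * w"
    and l: "0 < l"
    and a: "\<And>t. a (Suc (Suc t)) = p * a (Suc t) - 2 * \<beta> * \<alpha> * c (Suc t) + \<beta>\<^sup>2 * a t"
    and c: "\<And>t. c (Suc (Suc t)) = \<alpha> * a (Suc t) - \<beta> * c (Suc t)"
    and nonneg: "\<And>t. 0 \<le> a t" and cs: "\<And>t. 2 * \<bar>c (Suc t)\<bar> \<le> a (Suc t) + a t"
    and init: "u * a (Suc 0) + v * c (Suc 0) + w * a 0 \<noteq> 0" and K: "0 < K"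
  shows "limsup (\<lambda>t. ereal ((a t / K) powr (1 / real t))) \<ge> ereal l"
proof -
  \<comment> \<open>The left eigenvector paired with the moment vector; one time step multiplies it
    by \<open>l\<close>.\<close>
  define q where "q t = u * a (Suc t) + v * c (Suc t) + w * a t" for t
  define B where "B = \<bar>u\<bar> + \<bar>v\<bar> + \<bar>w\<bar> + 1"
  have B: "0 < B" by (simp add: B_def add_nonneg_pos)
  have "q (Suc t) = l * q t" for t
  proof -
    have "q (Suc t) = (u * p + v * \<alpha> + w) * a (Suc t) + (- 2 * \<beta> * \<alpha> * u - \<beta> * v) * c (Suc t) + \<beta>\<^sup>2 * u * a t"
      by (simp add: q_def a c algebra_simps)
    then show ?thesis unfolding eig by (simp add: q_def algebra_simps)
  qed
  then have q: "q t = l ^ t * q 0" for t by (induction t) auto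
  have bound: "\<bar>q t\<bar> \<le> B * (a (Suc t) + a t)" for t
  proof -
    have "\<bar>u * a (Suc t)\<bar> \<le> \<bar>u\<bar> * (a (Suc t) + a t)" "\<bar>w * a t\<bar> \<le> \<bar>w\<bar> * (a (Suc t) + a t)"
      using nonneg by (auto simp: abs_mult intro!: mult_left_mono)
    moreover have "\<bar>v * c (Suc t)\<bar> \<le> \<bar>v\<bar> * (a (Suc t) + a t)"
      using nonneg[of t] nonneg[of "Suc t"] cs[of t] unfolding abs_mult by (intro mult_left_mono) auto
    moreover have "0 \<le> a (Suc t) + a t" using nonneg by (simp add: add_nonneg_nonneg)
    moreover have "\<bar>x + y + z\<bar> \<le> \<bar>x\<bar> + \<bar>y\<bar> + \<bar>z\<bar>" for x y z :: real by linarith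
    from this[of "u * a (Suc t)" "v * c (Suc t)" "w * a t"]
    have "\<bar>q t\<bar> \<le> \<bar>u * a (Suc t)\<bar> + \<bar>v * c (Suc t)\<bar> + \<bar>w * a t\<bar>" by (simp add: q_def)
    ultimately show ?thesis unfolding B_def distrib_right mult_1_left by argo
  qed
  show ?thesis
  proof (rule limsup_root_ge[OF nonneg K _ l])
    show "0 < \<bar>q 0\<bar> / B" using init B by (simp add: q_def)
    show "\<bar>q 0\<bar> / B * l ^ t \<le> a (Suc t) + a t" for t
      using bound[of t] B l by (simp add: q[of t] abs_mult field_simps)
  qed
qed

section \<open>Matrices and measurability of the pseudo-inverse\<close>

lemma continuous_on_matrix_mult [continuous_intros]:
  fixes f :: "'x::topological_space \<Rightarrow> real^'b^'c" and g :: "'x \<Rightarrow> real^'d^'b"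
  assumes "continuous_on S f" "continuous_on S g"
  shows "continuous_on S (\<lambda>x. f x ** g x)"
  unfolding matrix_matrix_mult_def by (intro continuous_intros assms)

lemma continuous_on_transpose [continuous_intros]:
  fixes f :: "'x::topological_space \<Rightarrow> real^'b^'c"
  assumes "continuous_on S f"
  shows "continuous_on S (\<lambda>x. transpose (f x))"
  unfolding transpose_def by (intro continuous_intros assms)

lemma borel_measurable_vecI:
  fixes f :: "'x \<Rightarrow> 'a::euclidean_space^'n"
  assumes "\<And>i. (\<lambda>x. f x $ i) \<in> borel_measurable M"
  shows "f \<in> borel_measurable M"
  using assms by (subst borel_measurable_euclidean_space) (auto simp: Basis_vec_def inner_axis)

lemma borel_measurable_vec_nth:
  fixes f :: "'x \<Rightarrow> 'a::euclidean_space^'n"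
  assumes "f \<in> borel_measurable M"
  shows "(\<lambda>x. f x $ i) \<in> borel_measurable M"
  by (rule borel_measurable_continuous_on[OF _ assms]) (intro continuous_intros)

lemma borel_measurable_matrix_mult:
  fixes f :: "'x \<Rightarrow> real^'b^'c" and g :: "'x \<Rightarrow> real^'d^'b"
  assumes "f \<in> borel_measurable M" "g \<in> borel_measurable M"
  shows "(\<lambda>x. f x ** g x) \<in> borel_measurable M"
  by (rule borel_measurable_continuous_Pair[OF assms]) (intro continuous_intros)

lemma borel_measurable_matrix_vector_mult:
  fixes f :: "'x \<Rightarrow> real^'b^'c" and g :: "'x \<Rightarrow> real^'b"
  assumes "f \<in> borel_measurable M" "g \<in> borel_measurable M"
  shows "(\<lambda>x. f x *v g x) \<in> borel_measurable M"
  unfolding matrix_vector_mult_def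
  by (rule borel_measurable_continuous_Pair[OF assms]) (intro continuous_intros)

lemma borel_measurable_transpose:
  fixes f :: "'x \<Rightarrow> real^'b^'c"
  assumes "f \<in> borel_measurable M"
  shows "(\<lambda>x. transpose (f x)) \<in> borel_measurable M"
  by (rule borel_measurable_continuous_on[OF _ assms]) (intro continuous_intros)

text \<open>A closed set is a countable union of compact sets, and so is its projection.\<close>

lemma borel_fst_image_closed:
  fixes T :: "('a::euclidean_space \<times> 'b::euclidean_space) set"
  assumes "closed T"
  shows "fst ` T \<in> sets borel"
proof -
  have "T = (\<Union>n. T \<inter> cball 0 (real n))"
    using real_arch_simple by (auto simp: dist_norm)
  then have "fst ` T = (\<Union>n. fst ` (T \<inter> cball 0 (real n)))"
    by (metis image_UN)
  moreover have "compact (fst ` (T \<inter> cball 0 (real n)))" for n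
    using assms by (intro compact_continuous_image closed_Int_compact continuous_intros) auto
  then have "fst ` (T \<inter> cball 0 (real n)) \<in> sets borel" for n
    by (intro borel_closed compact_imp_closed)
  ultimately show ?thesis by auto
qed

text \<open>The graph of the pseudo-inverse is closed. On matrices without pseudo-inverse (there are
  none, but this is not needed) the definite description is a fixed junk value.\<close>

lemma borel_measurable_pseudo_inverse:
  "(pseudo_inverse :: real^'a^'b \<Rightarrow> real^'b^'a) \<in> borel_measurable borel"
proof -
  define G where "G = {p :: (real^'a^'b) \<times> (real^'b^'a). is_pseudo_inverse (fst p) (snd p)}"
  define j :: "real^'b^'a" where "j = (THE X. False)"
  have G: "closed G"
    unfolding G_def is_pseudo_inverse_def
    by (intro closed_Collect_conj closed_Collect_eq continuous_intros)
  have junk: "pseudo_inverse B = j" if "B \<notin> fst ` G" for B :: "real^'a^'b"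
  proof -
    have "is_pseudo_inverse B = (\<lambda>X. False)" using that by (auto simp: G_def image_iff)
    then show ?thesis by (simp add: pseudo_inverse_def j_def)
  qed
  have "pseudo_inverse -` F \<inter> space borel \<in> sets borel" if "closed F" for F :: "(real^'b^'a) set"
  proof -
    have "pseudo_inverse B \<in> F \<longleftrightarrow> B \<in> fst ` (G \<inter> UNIV \<times> F)" if "B \<in> fst ` G" for B
    proof -
      from that obtain X where X: "is_pseudo_inverse B X" by (auto simp: G_def)
      have "B \<in> fst ` (G \<inter> UNIV \<times> F) \<longleftrightarrow> (\<exists>Y\<in>F. is_pseudo_inverse B Y)"
        by (force simp: G_def image_iff)
      also have "\<dots> \<longleftrightarrow> pseudo_inverse B \<in> F"
        using X pseudo_inverse_eqI by blast
      finally show ?thesis by simp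
    qed
    moreover have "B \<notin> fst ` (G \<inter> UNIV \<times> F)" if "B \<notin> fst ` G" for B
      using that by blast
    ultimately have "B \<in> pseudo_inverse -` F \<longleftrightarrow>
        B \<in> fst ` (G \<inter> UNIV \<times> F) \<union> (if j \<in> F then - fst ` G else {})" for B
    proof (cases "B \<in> fst ` G")
      case True
      then have "pseudo_inverse B \<in> F \<longleftrightarrow> B \<in> fst ` (G \<inter> UNIV \<times> F)" by fact
      with True show ?thesis unfolding vimage_eq Un_iff by (cases "j \<in> F") simp_all
    next
      case False
      then have "pseudo_inverse B = j" "B \<notin> fst ` (G \<inter> UNIV \<times> F)" using junk by blast+
      with False show ?thesis unfolding vimage_eq Un_iff by (cases "j \<in> F") simp_all
    qed
    then have "pseudo_inverse -` F = fst ` (G \<inter> UNIV \<times> F) \<union> (if j \<in> F then - fst ` G else {})"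
      by (rule set_eqI)
    moreover have "closed (G \<inter> UNIV \<times> F)" using G that by (intro closed_Int closed_Times) auto
    ultimately show ?thesis using borel_fst_image_closed G by (auto simp: sets.compl_sets Compl_eq_Diff_UNIV)
  qed
  then show ?thesis by (subst (2) borel_eq_closed) (auto intro!: measurable_measure_of)
qed

lemma borel_measurable_sketched_gram:
  "(\<lambda>s. sketched_gram m s B) \<in> borel_measurable (sketch_space m)"
proof -
  have "(\<lambda>s. sketch_gram m s) \<in> borel_measurable (sketch_space m)"
    unfolding sketch_gram_def
  proof (intro borel_measurable_vecI, simp, intro borel_measurable_sum borel_measurable_times borel_measurable_vec_nth)
    show "(\<lambda>s. s i) \<in> borel_measurable (sketch_space m)" if "i \<in> {..<m}" for i
      unfolding sketch_space_def by (rule measurable_component_singleton[OF that])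
    then show "(\<lambda>s. s i) \<in> borel_measurable (sketch_space m)" if "i \<in> {..<m}" for i using that .
  qed
  then show ?thesis unfolding sketched_gram_def
    by (intro borel_measurable_matrix_mult) auto
qed

section \<open>Orthonormal factorization and inverses of congruent matrices\<close>

lemma inner_transpose_matrix_vector:
  fixes A :: "real^'d^'n"
  shows "x \<bullet> (transpose A *v y) = (A *v x) \<bullet> y"
  by (metis dot_lmul_matrix inner_commute transpose_matrix_vector)

text \<open>By injectivity the range of \<open>A\<close> has the dimension of the domain, so a
  linear isometry maps the domain onto it. Its matrix is \<open>U\<close>, and \<open>R\<close> is
  \<open>A\<close> followed by the inverse isometry.\<close>

lemma orthonormal_factorization:
  fixes A :: "real^'d^'n"
  assumes inj: "inj ((*v) A)"
  obtains U :: "real^'d^'n" and R where "transpose U ** U = mat 1" "invertible R" "A = U ** R"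
proof -
  have "dim (range ((*v) A)) = dim (UNIV :: (real^'d) set)"
    using inj by (intro dim_image_eq) auto
  then obtain f g where fg: "linear f" "linear g" "range f = range ((*v) A)"
      "\<And>x :: real^'d. norm (f x) = norm x" "\<And>x. x \<in> range ((*v) A) \<Longrightarrow> f (g x) = x"
    using isometries_subspaces[of "UNIV :: (real^'d) set" "range ((*v) A)"]
      linear_subspace_image[of "(*v) A" UNIV] by (metis UNIV_I matrix_vector_mul_linear subspace_UNIV)
  define U where "U = matrix f"
  define R where "R = matrix (g \<circ> (*v) A)"
  have U: "U *v x = f x" for x using fg(1) by (simp add: U_def matrix_works)
  have R: "R *v x = g (A *v x)" for x
    using fg(2) by (simp add: R_def matrix_works linear_compose)
  have UR: "U *v (R *v x) = A *v x" for x using fg(5) by (simp add: U R)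
  \<comment> \<open>Polarization: a linear map preserving norms preserves inner products.\<close>
  have "f x \<bullet> f y = x \<bullet> y" for x y
    using fg(1,4) by (simp add: dot_norm flip: linear_add)
  then have "x \<bullet> ((transpose U ** U) *v y) = x \<bullet> y" for x y
    by (simp add: U inner_transpose_matrix_vector del: transpose_matrix_vector flip: matrix_vector_mul_assoc)
  then have 1: "transpose U ** U = mat 1"
    unfolding matrix_eq matrix_vector_mul_lid using vector_eq_ldot by blast
  have "inj ((*v) R)" using inj UR by (metis inj_def)
  then have "invertible R"
    by (simp add: invertible_left_inverse matrix_left_invertible_injective)
  with 1 UR show thesis by (intro that) (auto simp: matrix_eq simp flip: matrix_vector_mul_assoc)
qed

lemma transpose_sketched_gram: "transpose (sketched_gram m s B) = sketched_gram m s B"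
proof -
  have "transpose (sketch_gram m s) = sketch_gram m s"
    by (simp add: sketch_gram_def transpose_def vec_eq_iff mult.commute)
  then show ?thesis by (simp add: sketched_gram_def matrix_transpose_mul matrix_mul_assoc)
qed

lemma matrix_inv_right:
  fixes B :: "real^'d^'d"
  assumes "invertible B"
  shows "B ** matrix_inv B = mat 1"
  using assms someI_ex[of "\<lambda>X. B ** X = mat 1 \<and> X ** B = mat 1"]
  unfolding invertible_def matrix_inv_def by blast

lemma matrix_inv_left:
  fixes B :: "real^'d^'d"
  assumes "invertible B"
  shows "matrix_inv B ** B = mat 1"
  using matrix_inv_right[OF assms] matrix_left_right_inverse by blast

lemma matrix_inv_eqI:
  fixes B :: "real^'d^'d"
  assumes "B ** X = mat 1"
  shows "matrix_inv B = X"
proof -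
  have "invertible B" using assms invertible_right_inverse by blast
  then have "matrix_inv B ** B ** X = X" by (simp add: matrix_inv_left)
  then show ?thesis by (simp add: assms flip: matrix_mul_assoc)
qed

lemma transpose_matrix_inv:
  fixes B :: "real^'d^'d"
  assumes "invertible B"
  shows "transpose (matrix_inv B) = matrix_inv (transpose B)"
proof (rule sym, rule matrix_inv_eqI)
  show "transpose B ** transpose (matrix_inv B) = mat 1"
    using matrix_inv_left[OF assms] by (simp add: transpose_mat flip: matrix_transpose_mul)
qed

text \<open>For invertible matrices the pseudo-inverse is the inverse, and the outer factors cancel.
  This turns the sketched Hessian of \<open>A = U R\<close> into the sketched Gram matrix of
  \<open>U\<close>.\<close>

lemma pseudo_inverse_congruence:
  fixes C R :: "real^'d^'d"
  assumes C: "invertible C" and R: "invertible R"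
  shows "R ** pseudo_inverse (transpose R ** C ** R) ** transpose R = matrix_inv C"
proof -
  let ?B = "transpose R ** C ** R"
  have B: "invertible ?B" using C R by (simp add: invertible_mult transpose_invertible)
  have "transpose R ** (C ** (R ** matrix_inv ?B)) ** transpose R = transpose R"
    using matrix_inv_right[OF B] by (simp add: matrix_mul_assoc)
  then have "matrix_inv (transpose R) ** (transpose R ** (C ** (R ** matrix_inv ?B)) ** transpose R) = mat 1"
    using R by (simp add: matrix_inv_left transpose_invertible)
  then have "C ** (R ** matrix_inv ?B ** transpose R) = mat 1"
    using R by (simp add: matrix_mul_assoc matrix_inv_left transpose_invertible)
  then show ?thesis
    by (simp add: matrix_inv_eqI pseudo_inverse_invertible[OF B])
qed

section \<open>Gradient and minimizer of the objective\<close>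

lemma gradient_eqI:
  assumes "GDERIV f x :> g" shows "gradient f x = g"
  unfolding gradient_def
proof (rule the_equality, rule assms)
  fix g' assume "GDERIV f x :> g'"
  then have "(\<lambda>h. h \<bullet> g') = (\<lambda>h. h \<bullet> g)"
    using assms unfolding gderiv_def by (rule has_derivative_unique)
  then show "g' = g" by (metis vector_eq_ldot)
qed

lemma hessian_inner: "x \<bullet> (hessian A *v y) = (A *v x) \<bullet> (A *v y)"
  by (simp add: hessian_def inner_transpose_matrix_vector del: transpose_matrix_vector
      flip: matrix_vector_mul_assoc)

lemma gradient_objective: "gradient (objective A b) x = hessian A *v x - b"
proof (rule gradient_eqI)
  have "((\<lambda>x. 1/2 * ((A *v x) \<bullet> (A *v x)) - b \<bullet> x) has_derivative
     (\<lambda>h. 1/2 * ((A *v x) \<bullet> (A *v h) + (A *v h) \<bullet> (A *v x)) - b \<bullet> h)) (at x)"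
    by (intro derivative_intros bounded_linear_imp_has_derivative) auto
  then show "GDERIV (objective A b) x :> hessian A *v x - b"
    unfolding gderiv_def objective_def hessian_inner
    by (rule has_derivative_eq_rhs) (auto simp: inner_diff_right hessian_inner inner_commute)
qed

text \<open>Since \<open>minimizer\<close> is a choice by \<open>arg_min\<close>, first only its
  objective value is identified with that of the solution \<open>z\<close> of the normal equations.
  Completing the square and injectivity of \<open>A\<close> then identify the point.\<close>

lemma hessian_minimizer:
  assumes inj: "inj ((*v) A)"
  shows "hessian A *v minimizer A b = b"
proof -
  have "inj ((*v) (hessian A))"
  proof (rule injI)
    fix x y assume "hessian A *v x = hessian A *v y"
    then have "(x - y) \<bullet> (hessian A *v (x - y)) = 0" by (simp add: matrix_vector_mult_diff_distrib)
    then have "A *v x = A *v y" unfolding hessian_inner by (simp add: matrix_vector_mult_diff_distrib)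
    then show "x = y" using inj by (simp add: inj_def)
  qed
  then have "invertible (hessian A)"
    by (simp add: invertible_left_inverse matrix_left_invertible_injective)
  then have z: "hessian A *v (matrix_inv (hessian A) *v b) = b"
    by (simp add: matrix_vector_mul_assoc matrix_inv_right)
  define z where "z = matrix_inv (hessian A) *v b"
  have b: "hessian A *v z = b" using z by (simp add: z_def)
  have sq: "objective A b x = objective A b z + 1/2 * ((A *v (x - z)) \<bullet> (A *v (x - z)))" for x
  proof -
    have "b \<bullet> y = (A *v y) \<bullet> (A *v z)" for y
      unfolding b[symmetric] inner_commute[of "hessian A *v z"] by (rule hessian_inner)
    then have obj: "objective A b y = 1/2 * ((A *v y) \<bullet> (A *v y)) - (A *v y) \<bullet> (A *v z)" for y
      unfolding objective_def hessian_inner by simp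
    have "(A *v (x - z)) \<bullet> (A *v (x - z))
        = (A *v x) \<bullet> (A *v x) - 2 * ((A *v x) \<bullet> (A *v z)) + (A *v z) \<bullet> (A *v z)"
      by (simp add: matrix_vector_mult_diff_distrib inner_diff inner_commute)
    then show ?thesis unfolding obj by linarith
  qed
  have "objective A b (minimizer A b) = objective A b z"
    unfolding minimizer_def
  proof (intro arg_min_equality)
    show "objective A b z \<le> objective A b x" for x unfolding sq[of x] by simp
  qed simp
  then have "A *v (minimizer A b) = A *v z"
    using sq[of "minimizer A b"] by (simp add: matrix_vector_mult_diff_distrib)
  then have "minimizer A b = z" using inj by (simp add: inj_def)
  then show ?thesis using b by simp
qed

section \<open>Moments of the randomized heavy-ball iteration\<close>

context prob_space
begin

text \<open>Each summand of the bilinear form factors by independence. As the mean of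
  \<open>Q\<close> is a multiple of the identity, only the diagonal summands survive.\<close>

lemma has_bochner_integral_inner_indep_matrix:
  fixes X Y :: "'a \<Rightarrow> real^'d" and Q :: "'a \<Rightarrow> real^'d^'d"
  assumes XY: "\<And>i j. integrable M (\<lambda>\<omega>. X \<omega> $ i * Y \<omega> $ j)"
    and indep: "\<And>i j. indep_var borel (\<lambda>\<omega>. X \<omega> $ i * Y \<omega> $ j) borel (\<lambda>\<omega>. Q \<omega> $ i $ j)"
    and Q: "has_bochner_integral M Q (\<theta> *\<^sub>R mat 1)"
  shows "has_bochner_integral M (\<lambda>\<omega>. X \<omega> \<bullet> (Q \<omega> *v Y \<omega>)) (\<theta> * expectation (\<lambda>\<omega>. X \<omega> \<bullet> Y \<omega>))"
proof -
  have Qij: "has_bochner_integral M (\<lambda>\<omega>. Q \<omega> $ i $ j) (\<theta> * (if i = j then 1 else 0))" for i j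
  proof -
    have "has_bochner_integral M (\<lambda>\<omega>. Q \<omega> $ i $ j) ((\<theta> *\<^sub>R mat 1 :: real^'d^'d) $ i $ j)"
      by (intro has_bochner_integral_bounded_linear[OF bounded_linear_vec_nth] Q)
    then show ?thesis by (simp add: mat_def)
  qed
  have "has_bochner_integral M (\<lambda>\<omega>. (X \<omega> $ i * Y \<omega> $ j) * Q \<omega> $ i $ j)
     (expectation (\<lambda>\<omega>. X \<omega> $ i * Y \<omega> $ j) * (\<theta> * (if i = j then 1 else 0)))" for i j
    using indep_var_integrable[OF indep XY] indep_var_lebesgue_integral[OF indep XY] Qij[of i j]
    by (simp add: has_bochner_integral_iff)
  then have "has_bochner_integral M (\<lambda>\<omega>. \<Sum>i\<in>UNIV. \<Sum>j\<in>UNIV. (X \<omega> $ i * Y \<omega> $ j) * Q \<omega> $ i $ j)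
     (\<Sum>i\<in>UNIV. \<Sum>j\<in>UNIV. expectation (\<lambda>\<omega>. X \<omega> $ i * Y \<omega> $ j) * (\<theta> * (if i = j then 1 else 0)))"
    by (intro has_bochner_integral_sum)
  moreover have "(\<lambda>\<omega>. \<Sum>i\<in>UNIV. \<Sum>j\<in>UNIV. (X \<omega> $ i * Y \<omega> $ j) * Q \<omega> $ i $ j)
      = (\<lambda>\<omega>. X \<omega> \<bullet> (Q \<omega> *v Y \<omega>))"
    by (simp add: inner_vec_def matrix_vector_mult_def sum_distrib_left mult_ac)
  moreover have "(\<Sum>i\<in>UNIV. \<Sum>j\<in>UNIV. expectation (\<lambda>\<omega>. X \<omega> $ i * Y \<omega> $ j) * (\<theta> * (if i = j then 1 else 0)))
      = \<theta> * expectation (\<lambda>\<omega>. X \<omega> \<bullet> Y \<omega>)"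
    by (simp add: inner_vec_def XY sum_distrib_left mult_ac if_distrib cong: if_cong)
  ultimately show ?thesis by simp
qed

end

lemma integrable_nth_mult:
  fixes X Y :: "'a \<Rightarrow> real^'d"
  assumes [measurable]: "X \<in> borel_measurable M" "Y \<in> borel_measurable M"
    and int: "integrable M (\<lambda>\<omega>. X \<omega> \<bullet> X \<omega>)" "integrable M (\<lambda>\<omega>. Y \<omega> \<bullet> Y \<omega>)"
  shows "integrable M (\<lambda>\<omega>. X \<omega> $ i * Y \<omega> $ j)"
proof (rule Bochner_Integration.integrable_bound)
  show "integrable M (\<lambda>\<omega>. X \<omega> \<bullet> X \<omega> + Y \<omega> \<bullet> Y \<omega>)" using int by auto
  have "(\<lambda>\<omega>. X \<omega> $ i) \<in> borel_measurable M" "(\<lambda>\<omega>. Y \<omega> $ j) \<in> borel_measurable M"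
    by (intro borel_measurable_vec_nth; measurable)+
  then show "(\<lambda>\<omega>. X \<omega> $ i * Y \<omega> $ j) \<in> borel_measurable M" by measurable
  have "\<bar>x $ i * y $ j\<bar> \<le> x \<bullet> x + y \<bullet> y" for x y :: "real^'d"
  proof -
    have "\<bar>x $ i * y $ j\<bar> \<le> norm x * norm y"
      unfolding abs_mult by (intro mult_mono component_le_norm_cart) auto
    also have "\<dots> \<le> (norm x)\<^sup>2 + (norm y)\<^sup>2"
      using sum_squares_bound[of "norm x" "norm y"] mult_nonneg_nonneg[OF norm_ge_zero norm_ge_zero, of x y] by linarith
    finally show ?thesis by (simp add: power2_norm_eq_inner)
  qed
  then show "AE \<omega> in M. norm (X \<omega> $ i * Y \<omega> $ j) \<le> norm (X \<omega> \<bullet> X \<omega> + Y \<omega> \<bullet> Y \<omega>)"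
    by (intro AE_I2) (simp add: order_trans[OF _ abs_ge_self])
qed

lemma integrable_inner_vec:
  fixes X Y :: "'a \<Rightarrow> real^'d"
  assumes "X \<in> borel_measurable M" "Y \<in> borel_measurable M"
    and "integrable M (\<lambda>\<omega>. X \<omega> \<bullet> X \<omega>)" "integrable M (\<lambda>\<omega>. Y \<omega> \<bullet> Y \<omega>)"
  shows "integrable M (\<lambda>\<omega>. X \<omega> \<bullet> Y \<omega>)"
  unfolding inner_vec_def inner_real_def
  by (intro Bochner_Integration.integrable_sum integrable_nth_mult assms)

fun heavy_ball :: "('s \<Rightarrow> real^'d^'d) \<Rightarrow> real \<Rightarrow> real \<Rightarrow> real^'d \<Rightarrow> real^'d \<Rightarrow> (nat \<Rightarrow> 's) \<Rightarrow> nat \<Rightarrow> real^'d"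
where
  "heavy_ball P \<mu> \<beta> z0 z1 s 0 = z0"
| "heavy_ball P \<mu> \<beta> z0 z1 s (Suc 0) = z1"
| "heavy_ball P \<mu> \<beta> z0 z1 s (Suc (Suc t)) =
     (1 + \<beta>) *\<^sub>R heavy_ball P \<mu> \<beta> z0 z1 s (Suc t)
     - \<mu> *\<^sub>R (P (s (Suc t)) *v heavy_ball P \<mu> \<beta> z0 z1 s (Suc t))
     - \<beta> *\<^sub>R heavy_ball P \<mu> \<beta> z0 z1 s t"

text \<open>The iterate at time \<open>t\<close> reads only the samples 1 to \<open>t - 1\<close>,
  hence is independent of the sample at time \<open>t\<close>.\<close>

lemma heavy_ball_restrict:
  "{1..<t} \<subseteq> J \<Longrightarrow> heavy_ball P \<mu> \<beta> z0 z1 (restrict s J) t = heavy_ball P \<mu> \<beta> z0 z1 s t"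
proof (induction P \<mu> \<beta> z0 z1 s t rule: heavy_ball.induct)
  case (3 P \<mu> \<beta> z0 z1 s t)
  from "3.prems" have "Suc t \<in> J" "{1..<Suc t} \<subseteq> J" "{1..<t} \<subseteq> J" by auto
  with 3 show ?case by simp
qed auto

lemma borel_measurable_heavy_ball:
  assumes P: "P \<in> borel_measurable N" and "{1..<t} \<subseteq> J"
  shows "(\<lambda>s. heavy_ball P \<mu> \<beta> z0 z1 s t) \<in> borel_measurable (PiM J (\<lambda>_. N))"
  using assms(2)
proof (induction t rule: less_induct)
  case (less t)
  show ?case
  proof (cases "t < 2")
    case True
    then consider "t = 0" | "t = Suc 0" by linarith
    then show ?thesis by cases auto
  next
    case False
    then obtain t' where t: "t = Suc (Suc t')" by (metis add_2_eq_Suc le_Suc_ex not_less)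
    with less.prems have J: "Suc t' \<in> J" "{1..<Suc t'} \<subseteq> J" "{1..<t'} \<subseteq> J" by auto
    have Z [measurable]: "(\<lambda>s. heavy_ball P \<mu> \<beta> z0 z1 s t') \<in> borel_measurable (PiM J (\<lambda>_. N))"
      "(\<lambda>s. heavy_ball P \<mu> \<beta> z0 z1 s (Suc t')) \<in> borel_measurable (PiM J (\<lambda>_. N))"
      using less.IH t J by auto
    have "(\<lambda>s. P (s (Suc t'))) \<in> borel_measurable (PiM J (\<lambda>_. N))"
      using measurable_compose[OF measurable_component_singleton[OF J(1)] P] .
    then have [measurable]: "(\<lambda>s. P (s (Suc t')) *v heavy_ball P \<mu> \<beta> z0 z1 s (Suc t')) \<in> borel_measurable (PiM J (\<lambda>_. N))"
      by (rule borel_measurable_matrix_vector_mult) (rule Z)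
    show ?thesis unfolding t by simp
  qed
qed

context prob_space
begin

text \<open>Expand the newest iterate. The fresh factor \<open>P\<close> is independent of the two
  earlier iterates, so \<open>(1 + \<beta>) I - \<mu> P\<close> has mean \<open>\<alpha> I\<close>
  and its Gram matrix has mean \<open>p I\<close>. The transpose is kept because \<open>P\<close>
  need not be symmetric on every sample.\<close>

lemma
  fixes P :: "'s \<Rightarrow> real^'d^'d" and S :: "nat \<Rightarrow> 'a \<Rightarrow> 's" and N :: "'s measure"
    and z0 z1 :: "real^'d" and \<mu> \<beta> \<theta>1 \<theta>2 :: real
  assumes indep: "indep_vars (\<lambda>_. N) S {1..}"
    and P: "P \<in> borel_measurable N"
    and mom1: "\<And>t. 1 \<le> t \<Longrightarrow> has_bochner_integral M (\<lambda>\<omega>. P (S t \<omega>)) (\<theta>1 *\<^sub>R mat 1)"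
    and mom2: "\<And>t. 1 \<le> t \<Longrightarrow> has_bochner_integral M
        (\<lambda>\<omega>. transpose (P (S t \<omega>)) ** P (S t \<omega>)) (\<theta>2 *\<^sub>R mat 1)"
  defines "Z \<equiv> \<lambda>t \<omega>. heavy_ball P \<mu> \<beta> z0 z1 (\<lambda>k. S k \<omega>) t"
    and "\<alpha> \<equiv> 1 + \<beta> - \<mu> * \<theta>1"
    and "p \<equiv> (1 + \<beta>)\<^sup>2 - 2 * (1 + \<beta>) * \<mu> * \<theta>1 + \<mu>\<^sup>2 * \<theta>2"
  defines "a \<equiv> \<lambda>t. expectation (\<lambda>\<omega>. Z t \<omega> \<bullet> Z t \<omega>)"
    and "c \<equiv> \<lambda>t. expectation (\<lambda>\<omega>. Z t \<omega> \<bullet> Z (t - 1) \<omega>)"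
  shows heavy_ball_second_moment:
      "a (Suc (Suc t)) = p * a (Suc t) - 2 * \<beta> * \<alpha> * c (Suc t) + \<beta>\<^sup>2 * a t"
    and heavy_ball_mixed_moment: "c (Suc (Suc t)) = \<alpha> * a (Suc t) - \<beta> * c (Suc t)"
    and heavy_ball_cauchy_schwarz: "2 * \<bar>c (Suc t)\<bar> \<le> a (Suc t) + a t"
proof -
  have Z_eq: "Z r \<omega> = heavy_ball P \<mu> \<beta> z0 z1 (restrict (\<lambda>k. S k \<omega>) J) r" if "{1..<r} \<subseteq> J" for r \<omega> J
    using that by (simp add: Z_def heavy_ball_restrict)
  have rv: "(\<lambda>\<omega>. restrict (\<lambda>k. S k \<omega>) J) \<in> measurable M (PiM J (\<lambda>_. N))" if "J \<subseteq> {1..}" for J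
    using indep that by (intro measurable_restrict) (auto simp: indep_vars_def)
  have Zm: "Z r \<in> borel_measurable M" for r
    unfolding Z_eq[OF order_refl]
    by (rule measurable_compose[OF rv borel_measurable_heavy_ball[OF P order_refl]]) auto
  \<comment> \<open>The times before \<open>t\<close> and the time \<open>t\<close> itself are
    disjoint blocks of an independent family; each side is a measurable function of one
    block.\<close>
  have indep_Z: "indep_var borel (\<lambda>\<omega>. Z r \<omega> $ i * Z q \<omega> $ j) borel (\<lambda>\<omega>. Q (S t \<omega>) $ i $ j)"
    if r: "r \<le> t" "q \<le> t" and t: "1 \<le> t" and Q: "Q \<in> borel_measurable N" for r q t i j Q
  proof -
    let ?X = "\<lambda>s. heavy_ball P \<mu> \<beta> z0 z1 s r $ i * heavy_ball P \<mu> \<beta> z0 z1 s q $ j"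
    have 1: "?X \<in> borel_measurable (PiM {1..<t} (\<lambda>_. N))"
      using r by (intro borel_measurable_times borel_measurable_vec_nth borel_measurable_heavy_ball P) auto
    have "(\<lambda>s. s t) \<in> measurable (PiM {t} (\<lambda>_. N)) N"
      by (rule measurable_component_singleton) simp
    from measurable_compose[OF this Q]
    have 2: "(\<lambda>s. Q (s t) $ i $ j) \<in> borel_measurable (PiM {t} (\<lambda>_. N))"
      by (intro borel_measurable_vec_nth)
    have "indep_var (PiM {1..<t} (\<lambda>_. N)) (\<lambda>\<omega>. restrict (\<lambda>k. S k \<omega>) {1..<t})
      (PiM {t} (\<lambda>_. N)) (\<lambda>\<omega>. restrict (\<lambda>k. S k \<omega>) {t})"
      using t by (intro indep_var_restrict[OF indep]) auto
    from indep_var_compose[OF this 1 2] show ?thesis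
      using r Z_eq[of r "{1..<t}"] Z_eq[of q "{1..<t}"] by (simp add: o_def)
  qed
  have Q2: "(\<lambda>s. transpose (P s) ** P s) \<in> borel_measurable N"
    by (intro borel_measurable_matrix_mult borel_measurable_transpose P)
  have Z_step: "Z (Suc (Suc t)) \<omega> = (1 + \<beta>) *\<^sub>R Z (Suc t) \<omega>
     - \<mu> *\<^sub>R (P (S (Suc t) \<omega>) *v Z (Suc t) \<omega>) - \<beta> *\<^sub>R Z t \<omega>" for t \<omega>
    by (simp add: Z_def)
  note expand = Z_step inner_diff_left inner_diff_right inner_scaleR_left inner_scaleR_right
  have step: "has_bochner_integral M (\<lambda>\<omega>. Z (Suc (Suc t)) \<omega> \<bullet> Z (Suc (Suc t)) \<omega>)
        (p * a (Suc t) - 2 * \<beta> * \<alpha> * c (Suc t) + \<beta>\<^sup>2 * a t)"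
      "has_bochner_integral M (\<lambda>\<omega>. Z (Suc (Suc t)) \<omega> \<bullet> Z (Suc t) \<omega>) (\<alpha> * a (Suc t) - \<beta> * c (Suc t))"
    if int: "integrable M (\<lambda>\<omega>. Z t \<omega> \<bullet> Z t \<omega>)" "integrable M (\<lambda>\<omega>. Z (Suc t) \<omega> \<bullet> Z (Suc t) \<omega>)" for t
  proof -
    let ?X = "Z (Suc t)" and ?Y = "Z t" and ?P = "\<lambda>\<omega>. P (S (Suc t) \<omega>)"
    have XX: "has_bochner_integral M (\<lambda>\<omega>. ?X \<omega> \<bullet> ?X \<omega>) (a (Suc t))"
      and YY: "has_bochner_integral M (\<lambda>\<omega>. ?Y \<omega> \<bullet> ?Y \<omega>) (a t)"
      and XY: "has_bochner_integral M (\<lambda>\<omega>. ?X \<omega> \<bullet> ?Y \<omega>) (c (Suc t))"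
      using int integrable_inner_vec[OF Zm Zm int(2) int(1)]
      by (simp_all add: a_def c_def has_bochner_integral_iff)
    have PX: "has_bochner_integral M (\<lambda>\<omega>. ?X \<omega> \<bullet> (?P \<omega> *v ?X \<omega>)) (\<theta>1 * a (Suc t))"
      unfolding a_def
      by (intro has_bochner_integral_inner_indep_matrix integrable_nth_mult Zm int indep_Z P mom1) auto
    have PY: "has_bochner_integral M (\<lambda>\<omega>. ?Y \<omega> \<bullet> (?P \<omega> *v ?X \<omega>)) (\<theta>1 * c (Suc t))"
      unfolding c_def diff_Suc_1 inner_commute[of "Z (Suc t) _"]
      by (intro has_bochner_integral_inner_indep_matrix integrable_nth_mult Zm int indep_Z P mom1) auto
    have "has_bochner_integral M
        (\<lambda>\<omega>. ?X \<omega> \<bullet> ((transpose (?P \<omega>) ** ?P \<omega>) *v ?X \<omega>)) (\<theta>2 * a (Suc t))"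
      unfolding a_def
      by (intro has_bochner_integral_inner_indep_matrix integrable_nth_mult Zm int
          indep_Z[OF _ _ _ Q2] mom2) auto
    then have PP: "has_bochner_integral M (\<lambda>\<omega>. (?P \<omega> *v ?X \<omega>) \<bullet> (?P \<omega> *v ?X \<omega>)) (\<theta>2 * a (Suc t))"
      by (simp add: inner_transpose_matrix_vector del: transpose_matrix_vector
          flip: matrix_vector_mul_assoc)
    note I = has_bochner_integral_add has_bochner_integral_diff has_bochner_integral_mult_right
    have "has_bochner_integral M (\<lambda>\<omega>. (1 + \<beta>)\<^sup>2 * (?X \<omega> \<bullet> ?X \<omega>) + \<mu>\<^sup>2 * ((?P \<omega> *v ?X \<omega>) \<bullet> (?P \<omega> *v ?X \<omega>))
        + \<beta>\<^sup>2 * (?Y \<omega> \<bullet> ?Y \<omega>) - 2 * (1 + \<beta>) * \<mu> * (?X \<omega> \<bullet> (?P \<omega> *v ?X \<omega>))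
        - 2 * (1 + \<beta>) * \<beta> * (?X \<omega> \<bullet> ?Y \<omega>) + 2 * \<mu> * \<beta> * (?Y \<omega> \<bullet> (?P \<omega> *v ?X \<omega>)))
      ((1 + \<beta>)\<^sup>2 * a (Suc t) + \<mu>\<^sup>2 * (\<theta>2 * a (Suc t)) + \<beta>\<^sup>2 * a t - 2 * (1 + \<beta>) * \<mu> * (\<theta>1 * a (Suc t))
        - 2 * (1 + \<beta>) * \<beta> * c (Suc t) + 2 * \<mu> * \<beta> * (\<theta>1 * c (Suc t)))"
      by (intro I XX YY XY PX PY PP)
    also have "(\<lambda>\<omega>. (1 + \<beta>)\<^sup>2 * (?X \<omega> \<bullet> ?X \<omega>) + \<mu>\<^sup>2 * ((?P \<omega> *v ?X \<omega>) \<bullet> (?P \<omega> *v ?X \<omega>))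
        + \<beta>\<^sup>2 * (?Y \<omega> \<bullet> ?Y \<omega>) - 2 * (1 + \<beta>) * \<mu> * (?X \<omega> \<bullet> (?P \<omega> *v ?X \<omega>))
        - 2 * (1 + \<beta>) * \<beta> * (?X \<omega> \<bullet> ?Y \<omega>) + 2 * \<mu> * \<beta> * (?Y \<omega> \<bullet> (?P \<omega> *v ?X \<omega>)))
        = (\<lambda>\<omega>. Z (Suc (Suc t)) \<omega> \<bullet> Z (Suc (Suc t)) \<omega>)"
      by (simp add: expand inner_commute power2_eq_square algebra_simps)
    also have "(1 + \<beta>)\<^sup>2 * a (Suc t) + \<mu>\<^sup>2 * (\<theta>2 * a (Suc t)) + \<beta>\<^sup>2 * a t - 2 * (1 + \<beta>) * \<mu> * (\<theta>1 * a (Suc t))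
        - 2 * (1 + \<beta>) * \<beta> * c (Suc t) + 2 * \<mu> * \<beta> * (\<theta>1 * c (Suc t))
        = p * a (Suc t) - 2 * \<beta> * \<alpha> * c (Suc t) + \<beta>\<^sup>2 * a t"
      unfolding p_def \<alpha>_def by algebra
    finally show "has_bochner_integral M (\<lambda>\<omega>. Z (Suc (Suc t)) \<omega> \<bullet> Z (Suc (Suc t)) \<omega>)
        (p * a (Suc t) - 2 * \<beta> * \<alpha> * c (Suc t) + \<beta>\<^sup>2 * a t)" .
    have "has_bochner_integral M (\<lambda>\<omega>. (1 + \<beta>) * (?X \<omega> \<bullet> ?X \<omega>) - \<mu> * (?X \<omega> \<bullet> (?P \<omega> *v ?X \<omega>))
        - \<beta> * (?X \<omega> \<bullet> ?Y \<omega>)) ((1 + \<beta>) * a (Suc t) - \<mu> * (\<theta>1 * a (Suc t)) - \<beta> * c (Suc t))"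
      by (intro I XX XY PX)
    moreover have "(\<lambda>\<omega>. (1 + \<beta>) * (?X \<omega> \<bullet> ?X \<omega>) - \<mu> * (?X \<omega> \<bullet> (?P \<omega> *v ?X \<omega>)) - \<beta> * (?X \<omega> \<bullet> ?Y \<omega>))
        = (\<lambda>\<omega>. Z (Suc (Suc t)) \<omega> \<bullet> ?X \<omega>)"
      by (simp add: expand inner_commute fun_eq_iff)
    moreover have "(1 + \<beta>) * a (Suc t) - \<mu> * (\<theta>1 * a (Suc t)) - \<beta> * c (Suc t) = \<alpha> * a (Suc t) - \<beta> * c (Suc t)"
      by (simp add: \<alpha>_def algebra_simps)
    ultimately show "has_bochner_integral M (\<lambda>\<omega>. Z (Suc (Suc t)) \<omega> \<bullet> ?X \<omega>) (\<alpha> * a (Suc t) - \<beta> * c (Suc t))"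
      by simp
  qed
  \<comment> \<open>The expansion needs two consecutive iterates to be square integrable, so the
    induction carries a pair, starting from constants.\<close>
  have "integrable M (\<lambda>\<omega>. Z t \<omega> \<bullet> Z t \<omega>) \<and> integrable M (\<lambda>\<omega>. Z (Suc t) \<omega> \<bullet> Z (Suc t) \<omega>)" for t
  proof (induction t)
    case 0
    then show ?case by (simp add: Z_def)
  next
    case (Suc t)
    then show ?case using step(1)[of t] by (auto simp: has_bochner_integral_iff)
  qed
  then have int: "integrable M (\<lambda>\<omega>. Z r \<omega> \<bullet> Z r \<omega>)" for r by blast
  show "a (Suc (Suc t)) = p * a (Suc t) - 2 * \<beta> * \<alpha> * c (Suc t) + \<beta>\<^sup>2 * a t"
    using step(1)[OF int int, of t] has_bochner_integral_integral_eq unfolding a_def by blast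
  show "c (Suc (Suc t)) = \<alpha> * a (Suc t) - \<beta> * c (Suc t)"
    using step(2)[OF int int, of t] has_bochner_integral_integral_eq by (simp add: c_def)
  have "\<bar>2 * c (Suc t)\<bar> \<le> expectation (\<lambda>\<omega>. \<bar>2 * (Z (Suc t) \<omega> \<bullet> Z t \<omega>)\<bar>)"
    unfolding c_def by (simp flip: integral_mult_right_zero)
  also have "\<dots> \<le> expectation (\<lambda>\<omega>. Z (Suc t) \<omega> \<bullet> Z (Suc t) \<omega> + Z t \<omega> \<bullet> Z t \<omega>)"
  proof (intro integral_mono)
    show "integrable M (\<lambda>\<omega>. \<bar>2 * (Z (Suc t) \<omega> \<bullet> Z t \<omega>)\<bar>)"
      using integrable_inner_vec[OF Zm Zm int int] by auto
    show "\<bar>2 * (x \<bullet> y)\<bar> \<le> x \<bullet> x + y \<bullet> y" for x y :: "real^'d"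
    proof -
      have "0 \<le> (x - y) \<bullet> (x - y)" "0 \<le> (x + y) \<bullet> (x + y)" by simp_all
      then show ?thesis by (simp add: inner_diff inner_add inner_commute abs_le_iff)
    qed
  qed (use int in auto)
  also have "\<dots> = a (Suc t) + a t" using int by (simp add: a_def)
  finally show "2 * \<bar>c (Suc t)\<bar> \<le> a (Suc t) + a t" by simp
qed

end

section \<open>Polyak-IHS\<close>

lemma hessian_orthonormal_mult:
  assumes "transpose U ** U = mat 1"
  shows "hessian (U ** R) = hessian R"
proof -
  have "hessian (U ** R) = transpose R ** (transpose U ** U) ** R"
    by (simp add: hessian_def matrix_transpose_mul matrix_mul_assoc)
  then show ?thesis using assms by (simp add: hessian_def)
qed

text \<open>For \<open>A = U R\<close> this equals \<open>C\<^sub>S\<close> inverse almost surely. Keeping the pseudo-inverse makes the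
  change of variables \<open>z = R (x - x*)\<close> exact on every sample, so no almost-everywhere argument
  about the iterates is needed.\<close>

definition preconditioner :: "nat \<Rightarrow> real^'d^'n \<Rightarrow> real^'d^'d \<Rightarrow> 'n::finite sketch \<Rightarrow> real^'d^'d" where
  "preconditioner m A R s = R ** pseudo_inverse (sketched_gram m s A) ** transpose R"

lemma preconditioner_eq_matrix_inv:
  assumes "invertible (sketched_gram m s U)" "invertible R"
  shows "preconditioner m (U ** R) R s = matrix_inv (sketched_gram m s U)"
proof -
  have "sketched_gram m s (U ** R) = transpose R ** sketched_gram m s U ** R"
    by (simp add: sketched_gram_def matrix_transpose_mul matrix_mul_assoc)
  then show ?thesis using assms by (simp add: preconditioner_def pseudo_inverse_congruence)
qed

lemma borel_measurable_preconditioner: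
  "preconditioner m A R \<in> borel_measurable (sketch_space m)"
  unfolding preconditioner_def
  by (intro borel_measurable_matrix_mult borel_measurable_const
      measurable_compose[OF borel_measurable_sketched_gram borel_measurable_pseudo_inverse])

text \<open>Wherever the Gram matrix of the sketched \<open>U\<close> is invertible, which is almost
  everywhere, \<open>P\<close> is its inverse and is symmetric. Measurability of \<open>P\<close>
  lets the moments pass along this almost sure equality.\<close>

lemma preconditioner_moments:
  fixes U :: "real^'d^'n" and \<D> :: "'n sketch measure"
  assumes mom: "inverse_moments TYPE('d) m \<D> \<theta>1 \<theta>2"
    and sets: "sets \<D> = sets (sketch_space m)"
    and U: "transpose U ** U = mat 1" and R: "invertible R"
  defines "P \<equiv> preconditioner m (U ** R) R"
  shows "has_bochner_integral \<D> P (\<theta>1 *\<^sub>R mat 1)"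
    and "has_bochner_integral \<D> (\<lambda>s. transpose (P s) ** P s) (\<theta>2 *\<^sub>R mat 1)"
proof -
  let ?C = "\<lambda>s. sketched_gram m s U"
  have inv: "AE s in \<D>. invertible (?C s)"
    and G1: "has_bochner_integral \<D> (\<lambda>s. matrix_inv (?C s)) (\<theta>1 *\<^sub>R mat 1)"
    and G2: "has_bochner_integral \<D> (\<lambda>s. matrix_inv (?C s) ** matrix_inv (?C s)) (\<theta>2 *\<^sub>R mat 1)"
    using mom U by (auto simp: inverse_moments_def)
  have P: "P \<in> borel_measurable \<D>"
    using borel_measurable_preconditioner sets unfolding P_def by (metis measurable_cong_sets)
  have P2: "(\<lambda>s. transpose (P s) ** P s) \<in> borel_measurable \<D>"
    by (intro borel_measurable_matrix_mult borel_measurable_transpose P)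
  have eq: "P s = matrix_inv (?C s)" "transpose (P s) = matrix_inv (?C s)" if "invertible (?C s)" for s
    using that R by (simp_all add: P_def preconditioner_eq_matrix_inv transpose_matrix_inv transpose_sketched_gram)
  have "AE s in \<D>. P s = matrix_inv (?C s)" using inv by eventually_elim (rule eq)
  then show "has_bochner_integral \<D> P (\<theta>1 *\<^sub>R mat 1)"
    using has_bochner_integral_cong_AE[OF P borel_measurable_has_bochner_integral[OF G1]] G1 by simp
  have "AE s in \<D>. transpose (P s) ** P s = matrix_inv (?C s) ** matrix_inv (?C s)"
    using inv by eventually_elim (simp add: eq(1) transpose_matrix_inv transpose_sketched_gram)
  then show "has_bochner_integral \<D> (\<lambda>s. transpose (P s) ** P s) (\<theta>2 *\<^sub>R mat 1)"
    using has_bochner_integral_cong_AE[OF P2 borel_measurable_has_bochner_integral[OF G2]] G2 by simp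
qed

text \<open>The gradient at \<open>x\<close> is \<open>transpose R *v z x\<close>, so applying
  \<open>R\<close> to the sketched Newton direction gives the preconditioner applied to
  \<open>z x\<close>. The minimizer cancels in the momentum difference.\<close>

lemma polyak_ihs_heavy_ball:
  fixes A :: "real^'d^'n" and R :: "real^'d^'d" and b :: "real^'d"
  assumes inj: "inj ((*v) A)" and H: "hessian A = hessian R"
  defines "z \<equiv> \<lambda>x. R *v (x - minimizer A b)"
  shows "z (polyak_ihs A b m \<mu> \<beta> x0 x1 s t) = heavy_ball (preconditioner m A R) \<mu> \<beta> (z x0) (z x1) s t"
proof (induction t rule: induct_nat_012)
  case (ge2 t)
  have "gradient (objective A b) x = transpose R *v z x" for x
  proof -
    have "gradient (objective A b) x = hessian R *v (x - minimizer A b)"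
      using hessian_minimizer[OF inj, of b]
      by (simp add: gradient_objective H matrix_vector_mult_diff_distrib)
    then show ?thesis
      by (simp add: hessian_def z_def del: transpose_matrix_vector flip: matrix_vector_mul_assoc)
  qed
  then have grad: "R *v (pseudo_inverse (sketched_gram m s' A) *v gradient (objective A b) x)
      = preconditioner m A R s' *v z x" for x s'
    by (simp add: preconditioner_def matrix_vector_mul_assoc matrix_mul_assoc del: transpose_matrix_vector)
  let ?x = "polyak_ihs A b m \<mu> \<beta> x0 x1 s"
  have "z (?x (Suc (Suc t))) = (1 + \<beta>) *\<^sub>R z (?x (Suc t))
      - \<mu> *\<^sub>R (R *v (pseudo_inverse (sketched_gram m (s (Suc t)) A) *v gradient (objective A b) (?x (Suc t))))
      - \<beta> *\<^sub>R z (?x t)"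
    by (simp add: z_def matrix_vector_mult_diff_distrib matrix_vector_right_distrib
        matrix_vector_mult_scaleR algebra_simps)
  then show ?case unfolding grad ge2 by simp
qed simp_all

lemma error_eq_hessian_factor:
  assumes "hessian A = hessian R"
  shows "error A b x = 1/2 * ((R *v (x - minimizer A b)) \<bullet> (R *v (x - minimizer A b)))"
  by (simp add: error_def assms hessian_inner)

theorem theorem4p3:
  fixes A :: "real^'d^'n" and b :: "real^'d"
    and D :: "nat \<Rightarrow> 'n sketch measure"
    and M :: "'w measure" and S :: "nat \<Rightarrow> 'w \<Rightarrow> 'n sketch"
    and m m0 :: nat and \<theta>1 \<theta>2 \<mu> \<beta> :: real
  assumes "CARD('d) \<le> CARD('n)"
    and "rank A = CARD('d)"
    and "random_embedding D"
    and "inverse_unbiased_moments TYPE('d) D m0"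
    and "m0 \<le> m"
    and "inverse_moments TYPE('d) m (D m) \<theta>1 \<theta>2"
    and "prob_space M"
    and "prob_space.indep_vars M (\<lambda>_. sketch_space m) S {1..}"
    and "\<And>t. 1 \<le> t \<Longrightarrow> distr M (sketch_space m) (S t) = D m"
    and "\<And>t. 1 \<le> t \<Longrightarrow> AE \<omega> in M. sketch_rank m (sketch_mult (S t \<omega>) A) = CARD('d)"
  shows "\<exists>x0 x1. x0 \<noteq> minimizer A b \<and>
    limsup (\<lambda>t. ereal ((expected_error M A b m \<mu> \<beta> S x0 x1 t
                         / expected_error M A b m \<mu> \<beta> S x0 x1 0) powr (1 / real t)))
      \<ge> ereal (1 - \<theta>1\<^sup>2 / \<theta>2)"
proof -
  interpret prob_space M by fact
  define xs where "xs = minimizer A b"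
  \<comment> \<open>Any unit vector serves: the moment recursion sees only the inner products of the
    initial vectors.\<close>
  define e :: "real^'d" where "e = axis undefined 1"
  have e: "e \<bullet> e = 1" by (simp add: e_def inner_axis_axis)
  then have "e \<noteq> 0" by auto
  show ?thesis
  proof (cases "0 < 1 - \<theta>1\<^sup>2 / \<theta>2")
    \<comment> \<open>The bound is nonpositive here, whereas every real power is nonnegative; only
      an \<open>x0\<close> away from the minimizer has to be supplied.\<close>
    case False
    then have "ereal (1 - \<theta>1\<^sup>2 / \<theta>2) \<le> limsup (\<lambda>t. ereal (f t powr (1 / real t)))" for f
      by (intro le_Limsup always_eventually allI) (auto intro: order_trans[OF _ powr_ge_zero])
    then show ?thesis using \<open>e \<noteq> 0\<close> by (intro exI[of _ "xs + e"] exI conjI) (auto simp: xs_def)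
  next
    case rho: True
    have inj: "inj ((*v) A)" using assms(2) full_rank_injective by blast
    obtain U :: "real^'d^'n" and R where U: "transpose U ** U = mat 1" and R: "invertible R" and A: "A = U ** R"
      using orthonormal_factorization[OF inj] .
    have H: "hessian A = hessian R" unfolding A by (rule hessian_orthonormal_mult[OF U])
    define P where "P = preconditioner m A R"
    have \<theta>: "0 < \<theta>1" "0 < \<theta>2" using assms(6) by (auto simp: inverse_moments_def)
    have "1 \<le> m" using assms(4,5) by (simp add: inverse_unbiased_moments_def)
    then have sets: "sets (D m) = sets (sketch_space m)" using assms(3) by (simp add: random_embedding_def)
    have P: "P \<in> borel_measurable (sketch_space m)"
      unfolding P_def by (rule borel_measurable_preconditioner)
    then have P2: "(\<lambda>s. transpose (P s) ** P s) \<in> borel_measurable (sketch_space m)"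
      by (intro borel_measurable_matrix_mult borel_measurable_transpose)
    have St: "S t \<in> measurable M (sketch_space m)" if "1 \<le> t" for t
      using assms(8) that by (auto simp: indep_vars_def)
    have transfer: "has_bochner_integral M (\<lambda>\<omega>. f (S t \<omega>)) y"
      if "1 \<le> t" "f \<in> borel_measurable (sketch_space m)" "has_bochner_integral (D m) f y"
      for t f and y :: "real^'d^'d"
      using that(3) unfolding assms(9)[OF that(1), symmetric] has_bochner_integral_iff
      by (simp add: integrable_distr_eq[OF St[OF that(1)] that(2)] integral_distr[OF St[OF that(1)] that(2)])
    note moments = preconditioner_moments[OF assms(6) sets U R, folded A, folded P_def]
    obtain l u v w where l: "1 - \<theta>1\<^sup>2 / \<theta>2 \<le> l"
      and eig: "u * ((1 + \<beta>)\<^sup>2 - 2 * (1 + \<beta>) * \<mu> * \<theta>1 + \<mu>\<^sup>2 * \<theta>2) + v * (1 + \<beta> - \<mu> * \<theta>1) + w = l * u"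
        "- 2 * \<beta> * (1 + \<beta> - \<mu> * \<theta>1) * u - \<beta> * v = l * v" "\<beta>\<^sup>2 * u = l * w"
      and "u \<noteq> 0 \<or> v \<noteq> 0"
      using moment_matrix_left_eigenvector[OF \<theta> rho] .
    then obtain r where r: "u * r\<^sup>2 + v * r + w \<noteq> 0"
      using binary_quadratic_form_nonzero by blast
    \<comment> \<open>In the variable \<open>z\<close> the start is \<open>e\<close> and
      \<open>r *\<^sub>R e\<close>. The initial moments are then 1, \<open>r\<close> and
      \<open>r\<^sup>2\<close>, and their pairing with the eigenvector is the nonzero value of the
      quadratic form at \<open>r\<close>.\<close>
    define x0 where "x0 = xs + matrix_inv R *v e"
    define x1 where "x1 = xs + r *\<^sub>R (matrix_inv R *v e)"
    have R0: "R *v (x0 - xs) = e" and R1: "R *v (x1 - xs) = r *\<^sub>R e"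
      by (simp_all add: x0_def x1_def matrix_vector_mult_scaleR matrix_vector_mul_assoc matrix_inv_right[OF R])
    define Z where "Z t \<omega> = heavy_ball P \<mu> \<beta> e (r *\<^sub>R e) (\<lambda>k. S k \<omega>) t" for t \<omega>
    define a where "a t = expectation (\<lambda>\<omega>. Z t \<omega> \<bullet> Z t \<omega>)" for t
    define c where "c t = expectation (\<lambda>\<omega>. Z t \<omega> \<bullet> Z (t - 1) \<omega>)" for t
    have mom1: "has_bochner_integral M (\<lambda>\<omega>. P (S t \<omega>)) (\<theta>1 *\<^sub>R mat 1)"
      and mom2: "has_bochner_integral M (\<lambda>\<omega>. transpose (P (S t \<omega>)) ** P (S t \<omega>)) (\<theta>2 *\<^sub>R mat 1)"
      if "1 \<le> t" for t
      using transfer[OF that P moments(1)] transfer[OF that P2 moments(2)] by auto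
    have init: "a 0 = 1" "a (Suc 0) = r\<^sup>2" "c (Suc 0) = r"
      by (simp_all add: a_def c_def Z_def e power2_eq_square prob_space)
    \<comment> \<open>The factor 1/2 cancels in the ratio of expected errors.\<close>
    have err: "expected_error M A b m \<mu> \<beta> S x0 x1 t = 1/2 * a t" for t
      using polyak_ihs_heavy_ball[OF inj H, of b m \<mu> \<beta> x0 x1]
      by (simp add: expected_error_def error_eq_hessian_factor[OF H] a_def Z_def P_def R0 R1 flip: xs_def)
    have "limsup (\<lambda>t. ereal ((a t / a 0) powr (1 / real t))) \<ge> ereal l"
    proof (rule moment_recursion_limsup[OF eig])
      show "a (Suc (Suc t)) = ((1 + \<beta>)\<^sup>2 - 2 * (1 + \<beta>) * \<mu> * \<theta>1 + \<mu>\<^sup>2 * \<theta>2) * a (Suc t)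
          - 2 * \<beta> * (1 + \<beta> - \<mu> * \<theta>1) * c (Suc t) + \<beta>\<^sup>2 * a t" for t
        unfolding a_def c_def Z_def by (rule heavy_ball_second_moment[OF assms(8) P]) (fact mom1 mom2)+
      show "c (Suc (Suc t)) = (1 + \<beta> - \<mu> * \<theta>1) * a (Suc t) - \<beta> * c (Suc t)" for t
        unfolding a_def c_def Z_def by (rule heavy_ball_mixed_moment[OF assms(8) P]) (fact mom1 mom2)+
      show "2 * \<bar>c (Suc t)\<bar> \<le> a (Suc t) + a t" for t
        unfolding a_def c_def Z_def by (rule heavy_ball_cauchy_schwarz[OF assms(8) P]) (fact mom1 mom2)+
      show "0 < l" using rho l by simp
      show "0 \<le> a t" for t by (simp add: a_def)
    qed (use init r in auto)
    then have "limsup (\<lambda>t. ereal ((expected_error M A b m \<mu> \<beta> S x0 x1 t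
        / expected_error M A b m \<mu> \<beta> S x0 x1 0) powr (1 / real t))) \<ge> ereal l"
      by (simp add: err)
    moreover have "x0 \<noteq> xs" using R0 \<open>e \<noteq> 0\<close> by auto
    ultimately show ?thesis unfolding xs_def using l by (meson ereal_less_eq(3) order_trans)
  qed
qed

end
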